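(* Let $q$ be a prime power, let $r\ge 1$ be an integer, and let $\alpha_1,\ldots,\alpha_r$ be independent Haar-random elements of $\mathfrak p=t^{-1}\mathbb F_q[[t^{-1}]]$. For $n\ge 0$ let $L_r(n)$, $Q_n$ and $\rho^{(r)}_n\in\mathbb F_q^r$ be the minimal common-denominator length, the monic minimal denominator and the residual vector defined in the context. Then the random vectors $\rho^{(r)}_0,\rho^{(r)}_1,\ldots$ are independent and identically distributed, each uniformly distributed on $\mathbb F_q^r$. Moreover, for every $n\ge0$, $$J^{(r)}_n:=\mathbf 1_{\{L_r(n+1)>L_r(n)\}}=\mathbf 1_{\{\rho^{(r)}_n\neq 0\}}.$$ Consequently, the variables $J^{(r)}_0,J^{(r)}_1,\ldots$ are iid Bernoulli variables with $\mathbb P(J^{(r)}_n=1)=1-q^{-r}$. Conditionally on $J^{(r)}_n=1$, the projective class $[\rho^{(r)}_n]\in\mathbb P^{r-1}(\mathbb F_q)$ is uniformly distributed on $\mathbb P^{r-1}(\mathbb F_q)$.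
   Context: $K=\mathbb F_q((t^{-1}))$ is the field of Laurent series in $t^{-1}$, and $\mathfrak p=t^{-1}\mathbb F_q[[t^{-1}]]$ is its compact additive subgroup of fractional series. Write $\alpha_i=\sum_{j\ge1}u^{(i)}_jt^{-j}$ with $u_j^{(i)}\in\mathbb F_q$. $\mathfrak p^r$ carries product Haar probability measure; equivalently the coefficient vectors $(u^{(1)}_j,\ldots,u^{(r)}_j)$, $j\ge1$, are iid uniform on $\mathbb F_q^r$. For $x=\sum_j a_jt^j\in K$ put $[t^m]x=a_m$, and let the cancellation length be $c(x)=\max\{n\ge0:[t^{-1}]x=\cdots=[t^{-n}]x=0\}$, with $c(x)=\infty$ if all negative coefficients vanish. For nonzero $Q\in\mathbb F_q[t]$ let $d(Q)=\deg Q+1$ (its coefficient length). For $n\ge0$ define $$L_r(n)=\min\{d(Q): 0\ne Q\in\mathbb F_q[t],\ c(Q\alpha_i)\ge n\text{ for all }1\le i\le r\}.$$ The set consisting of $0$ and all $Q\in\mathbb F_q[t]$ with $\deg Q<L_r(n)$ and $c(Q\alpha_i)\ge n$ for all $i$ is a one-dimensional $\mathbb F_q$-vector space; $Q_n$ denotes its unique monic element (of degree $L_r(n)-1$). The residual vector is $$\rho^{(r)}_n=\bigl([t^{-(n+1)}]Q_n\alpha_1,\ldots,[t^{-(n+1)}]Q_n\alpha_r\bigr)\in\mathbb F_q^r.$$ $\mathbb P^{r-1}(\mathbb F_q)=(\mathbb F_q^r\setminus\{0\})/\mathbb F_q^\times$, and $[v]$ is the class of $v\ne0$. *)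

theory Defs
  imports
    "HOL-Probability.Probability"
    "HOL-Computational_Algebra.Computational_Algebra"
begin

text \<open>
  The field \<open>K = F\<^sub>q((1/t))\<close> is the library type \<^typ>\<open>'a fls\<close> over a finite field \<^typ>\<open>'a\<close>, whose formal
  variable \<^term>\<open>fls_X\<close> plays the role of \<open>1/t\<close>; thus \<open>t\<close> is \<^term>\<open>fls_X_inv\<close>, exponents change
  sign, and the metric of \<^typ>\<open>'a fls\<close> is the usual \<open>1/t\<close>-adic one.
\<close>

definition coeff_t :: "'a::zero fls \<Rightarrow> int \<Rightarrow> 'a" where
  "coeff_t x m = fls_nth x (- m)"

definition poly_to_K :: "'a::field poly \<Rightarrow> 'a fls" where
  "poly_to_K Q = poly (map_poly fls_const Q) fls_X_inv"

definition frac_series :: "'a::zero fls set" where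
  "frac_series = {x. \<forall>m\<ge>0. coeff_t x m = 0}"

definition frac_borel :: "'a::field fls measure" where
  "frac_borel = restrict_space borel frac_series"

definition haar_prob :: "'a::field fls measure \<Rightarrow> bool" where
  "haar_prob \<mu> \<longleftrightarrow> prob_space \<mu> \<and> sets \<mu> = sets frac_borel \<and>
     (\<forall>y\<in>frac_series. \<forall>A\<in>sets \<mu>. emeasure \<mu> ((+) y ` A) = emeasure \<mu> A)"

definition cancel_length :: "'a::zero fls \<Rightarrow> enat" where
  "cancel_length x =
     (if \<forall>k::nat. k \<ge> 1 \<longrightarrow> coeff_t x (- int k) = 0 then \<infinity>
      else enat (Max {n. \<forall>k\<in>{1..n}. coeff_t x (- int k) = 0}))"

definition coeff_length :: "'a::zero poly \<Rightarrow> nat" where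
  "coeff_length Q = degree Q + 1"

text \<open>
  An element of \<open>K\<^sup>r\<close> is a function from a finite index type \<^typ>\<open>'r\<close> with \<open>r = CARD('r)\<close>.
\<close>

definition min_length :: "('r \<Rightarrow> 'a::field fls) \<Rightarrow> nat \<Rightarrow> nat" where
  "min_length a n =
     (LEAST l. \<exists>Q. Q \<noteq> 0 \<and> l = coeff_length Q \<and>
        (\<forall>i. cancel_length (poly_to_K Q * a i) \<ge> enat n))"

definition min_denom :: "('r \<Rightarrow> 'a::field fls) \<Rightarrow> nat \<Rightarrow> 'a poly" where
  "min_denom a n =
     (THE Q. lead_coeff Q = 1 \<and> degree Q < min_length a n \<and>
        (\<forall>i. cancel_length (poly_to_K Q * a i) \<ge> enat n))"

definition residual :: "('r::finite \<Rightarrow> 'a::field fls) \<Rightarrow> nat \<Rightarrow> 'a ^ 'r" where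
  "residual a n = (\<chi> i. coeff_t (poly_to_K (min_denom a n) * a i) (- (int n + 1)))"

definition jump :: "('r \<Rightarrow> 'a::field fls) \<Rightarrow> nat \<Rightarrow> nat" where
  "jump a n = of_bool (min_length a (n + 1) > min_length a n)"

definition proj_rel :: "(('a::field ^ 'r) \<times> ('a ^ 'r)) set" where
  "proj_rel = {(v, w). v \<noteq> 0 \<and> w \<noteq> 0 \<and> (\<exists>c. c \<noteq> 0 \<and> w = c *s v)}"

definition proj_space :: "('a::field ^ 'r) set set" where
  "proj_space = (UNIV - {0}) // proj_rel"

text \<open>\<open>proj_class 0\<close> is the empty set, which is not a point of \<^term>\<open>proj_space\<close>.\<close>

definition proj_class :: "'a::field ^ 'r \<Rightarrow> ('a ^ 'r) set" where
  "proj_class v = proj_rel `` {v}"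

end

theory Submission
  imports Defs
begin

text \<open>
  Write \<open>u\<^sub>k\<close> for the vector of coefficients of \<open>t\<^sup>-\<^sup>k\<close> in \<open>\<alpha>\<close>. Deciding that a polynomial \<open>Q\<close> cancels the
  first \<open>n\<close> fractional coefficients involves only \<open>u\<^sub>1, \<dots>, u\<^sub>m\<close> with \<open>m = n + deg Q\<close>. Hence \<open>Q\<^sub>n\<close>, and
  with it the number \<open>N(n) = n + deg Q\<^sub>n\<close>, called the horizon below, is found by reading \<open>\<alpha>\<close> from
  left to right up to \<open>u\<^bsub>N(n)\<^esub>\<close> and no further: the horizon is a stopping time (\<open>horizon_cong\<close>,
  \<open>min_denom_cong\<close>). As \<open>Q\<^sub>n\<close> is monic, the residual \<open>\<rho>\<^sub>n\<close> is a function of the coefficients already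
  read plus the first unread vector \<open>u\<^bsub>N(n)+1\<^esub>\<close>. Since \<open>deg Q\<^sub>n\<close> does not decrease, \<open>N(n)\<close> increases strictly,
  so all earlier residuals depend on coefficients up to \<open>u\<^bsub>N(n)\<^esub>\<close> only.

  The uniformity of that fresh vector is used in the form of translation invariance. On the event
  that the horizon equals \<open>m\<close>, adding \<open>c t\<^bsup>-(m+1)\<^esup>\<close> to \<open>\<alpha>\<close> preserves the joint law, the horizon and the history
  \<open>\<rho>\<^sub>0, \<dots>, \<rho>\<^bsub>n-1\<^esub>\<close>, and replaces \<open>\<rho>\<^sub>n\<close> by \<open>\<rho>\<^sub>n + c\<close>. So for every event \<open>H\<close> about the history,
  \<open>P(H \<and> \<rho>\<^sub>n = v)\<close> does not depend on \<open>v\<close> (\<open>prob_res_with_history\<close>), which by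
  induction gives the product formula \<open>prob_res_history\<close> and hence independence and uniformity.

  The jump criterion is deterministic: \<open>\<rho>\<^sub>n = 0\<close> says exactly that \<open>Q\<^sub>n\<close> also serves for \<open>n + 1\<close>, and by
  uniqueness of the monic minimal denominator this is the only way for the length to stay the same.
  The statements about the jumps follow by applying a function to \<open>\<rho>\<^sub>n\<close>, and the one about
  projective classes because every projective point consists of \<open>q - 1\<close> vectors.
\<close>

section \<open>Common denominators\<close>

definition common_denom :: "('r \<Rightarrow> 'a::field fls) \<Rightarrow> nat \<Rightarrow> 'a poly \<Rightarrow> bool" where
  "common_denom a n Q \<longleftrightarrow> (\<forall>i. \<forall>k\<in>{1..n}. coeff_t (poly_to_K Q * a i) (- int k) = 0)"

lemma coeff_t_poly_to_K_mult:
  fixes Q :: "'a::field poly"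
  assumes "degree Q \<le> D"
  shows "coeff_t (poly_to_K Q * x) m = (\<Sum>j\<le>D. coeff Q j * coeff_t x (m - int j))"
proof -
  have deg: "degree (map_poly fls_const Q) = degree Q"
    by (cases "Q = 0") (auto intro!: map_poly_degree_eq simp: fls_const_nonzero)
  have "poly_to_K Q = (\<Sum>j\<le>degree Q. fls_const (coeff Q j) * fls_X_inv ^ j)"
    unfolding poly_to_K_def poly_altdef deg by (simp add: coeff_map_poly)
  also have "\<dots> = (\<Sum>j\<le>D. fls_const (coeff Q j) * fls_X_inv ^ j)"
    using assms by (intro sum.mono_neutral_left) (auto simp: coeff_eq_0)
  finally have "poly_to_K Q * x = (\<Sum>j\<le>D. fls_const (coeff Q j) * (fls_X_inv ^ j * x))"
    by (simp add: sum_distrib_right mult.assoc)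
  then have "fls_nth (poly_to_K Q * x) (- m) = (\<Sum>j\<le>D. coeff Q j * fls_nth x (- m + int j))"
    by (simp add: fls_nth_sum fls_X_inv_power_times_conv_shift)
  then show ?thesis
    by (simp add: coeff_t_def add.commute)
qed

lemma cancel_length_ge_iff:
  "enat n \<le> cancel_length x \<longleftrightarrow> (\<forall>k\<in>{1..n}. coeff_t x (- int k) = 0)"
proof (cases "\<forall>k::nat. k \<ge> 1 \<longrightarrow> coeff_t x (- int k) = 0")
  case True
  then show ?thesis by (simp add: cancel_length_def)
next
  case False
  define S where "S = {n. \<forall>k\<in>{1..n}. coeff_t x (- int k) = 0}"
  from False obtain k where k: "k \<ge> 1" "coeff_t x (- int k) \<noteq> 0" by auto
  have "S \<subseteq> {..<k}"
    using k by (force simp: S_def not_less)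
  then have fin: "finite S" by (rule finite_subset) simp
  moreover have "S \<noteq> {}" by (auto simp: S_def intro: exI[of _ 0])
  ultimately have "n \<le> Max S \<longleftrightarrow> (\<exists>m\<in>S. n \<le> m)"
    by (simp add: Max_ge_iff)
  also have "\<dots> \<longleftrightarrow> n \<in> S"
    by (force simp: S_def)
  finally have "n \<le> Max S \<longleftrightarrow> n \<in> S" .
  moreover have "cancel_length x = enat (Max S)"
    unfolding cancel_length_def S_def using False by (subst if_not_P) auto
  ultimately show ?thesis
    by (simp add: S_def)
qed

lemma all_cancel_length_ge_iff:
  "(\<forall>i. cancel_length (poly_to_K Q * a i) \<ge> enat n) \<longleftrightarrow> common_denom a n Q"
  by (simp add: common_denom_def cancel_length_ge_iff)

lemma common_denom_diff:
  assumes "common_denom a n P" "common_denom a n Q"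
  shows "common_denom a n (P - Q)"
proof -
  define D where "D = max (degree P) (degree Q)"
  have "degree P \<le> D" "degree Q \<le> D" "degree (P - Q) \<le> D"
    by (auto simp: D_def degree_diff_le_max)
  then show ?thesis
    using assms unfolding common_denom_def
    by (simp add: coeff_t_poly_to_K_mult sum_subtractf left_diff_distrib)
qed

lemma common_denom_smult:
  assumes "common_denom a n Q"
  shows "common_denom a n (smult c Q)"
  using assms unfolding common_denom_def
  by (simp add: coeff_t_poly_to_K_mult[OF degree_smult_le] coeff_t_poly_to_K_mult[OF order_refl]
      mult.assoc flip: sum_distrib_left)

lemma common_denom_Suc_imp: "common_denom a (Suc n) Q \<Longrightarrow> common_denom a n Q"
  by (auto simp: common_denom_def)

text \<open>
  Two monomials suffice: \<open>t\<^sup>j\<close> acts on the first \<open>n\<close> fractional coefficients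
  through a table with finitely many possible values, so two different exponents \<open>j\<close> and \<open>l\<close> give the
  same table, and \<open>t\<^sup>j - t\<^sup>l\<close> is a common denominator.
\<close>
lemma ex_common_denom:
  fixes a :: "'r::finite \<Rightarrow> 'a::{field,finite} fls"
  shows "\<exists>Q. Q \<noteq> 0 \<and> common_denom a n Q"
proof -
  define f where
    "f j = (\<lambda>(i, k)\<in>UNIV \<times> {1..n}. coeff_t (a i) (- int k - int j))" for j :: nat
  have "range f \<subseteq> (UNIV \<times> {1..n}) \<rightarrow>\<^sub>E UNIV"
    unfolding f_def by (intro image_subsetI restrict_PiE_iff[THEN iffD2]) simp
  moreover have "finite ((UNIV \<times> {1..n}) \<rightarrow>\<^sub>E (UNIV :: 'a set) :: ('r \<times> nat \<Rightarrow> 'a) set)"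
    by (intro finite_PiE) auto
  ultimately have "finite (range f)" by (rule finite_subset)
  then have "\<not> inj f" using finite_imageD by blast
  then obtain j l where jl: "j \<noteq> l" "f j = f l" by (auto simp: inj_def)
  define Q where "Q = monom (1::'a) j - monom 1 l"
  have "coeff Q j = 1" using jl by (simp add: Q_def)
  then have "Q \<noteq> 0" by auto
  moreover have "common_denom a n Q"
    unfolding common_denom_def
  proof (intro allI ballI)
    fix i k assume k: "k \<in> {1..n}"
    have monom: "coeff_t (poly_to_K (monom 1 p) * a i) (- int k) = f p (i, k)" for p
    proof -
      have "coeff_t (poly_to_K (monom 1 p) * a i) (- int k) =
          (\<Sum>q\<le>p. (if q = p then coeff_t (a i) (- int k - int q) else 0))"
        by (subst coeff_t_poly_to_K_mult[OF degree_monom_le]) (intro sum.cong, auto)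
      then show ?thesis using k by (simp add: f_def)
    qed
    have D: "degree (monom (1::'a) j) \<le> max j l" "degree (monom (1::'a) l) \<le> max j l"
      "degree Q \<le> max j l"
      by (auto simp: Q_def degree_monom_eq intro: order.trans[OF degree_diff_le_max])
    have "coeff_t (poly_to_K Q * a i) (- int k) = f j (i, k) - f l (i, k)"
      unfolding monom[symmetric] coeff_t_poly_to_K_mult[OF D(1)] coeff_t_poly_to_K_mult[OF D(2)]
        coeff_t_poly_to_K_mult[OF D(3)]
      by (simp only: Q_def coeff_diff left_diff_distrib sum_subtractf)
    then show "coeff_t (poly_to_K Q * a i) (- int k) = 0" using jl by simp
  qed
  ultimately show ?thesis by blast
qed

section \<open>The minimal denominator\<close>

lemma min_length_attained:
  fixes a :: "'r::finite \<Rightarrow> 'a::{field,finite} fls"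
  obtains Q where "Q \<noteq> 0" "coeff_length Q = min_length a n" "common_denom a n Q"
proof -
  have "\<exists>l Q. Q \<noteq> 0 \<and> l = coeff_length Q \<and> common_denom a n Q"
    using ex_common_denom[of a n] by blast
  then have "\<exists>Q. Q \<noteq> 0 \<and> min_length a n = coeff_length Q \<and> common_denom a n Q"
    unfolding min_length_def all_cancel_length_ge_iff by (rule LeastI_ex)
  then show ?thesis using that by auto
qed

lemma min_length_le:
  assumes "Q \<noteq> 0" "common_denom a n Q"
  shows "min_length a n \<le> coeff_length Q"
  unfolding min_length_def all_cancel_length_ge_iff using assms by (intro Least_le) auto

text \<open>
  The difference of two monic denominators of the same minimal degree is a denominator of smaller
  degree, which must vanish.
\<close>
lemma monic_min_denom_unique:
  assumes "lead_coeff P = 1" "degree P < min_length a n" "common_denom a n P"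
    and "lead_coeff Q = 1" "degree Q < min_length a n" "common_denom a n Q"
  shows "P = Q"
proof (rule ccontr)
  assume "P \<noteq> Q"
  have nz: "P \<noteq> 0" "Q \<noteq> 0" using assms by auto
  have deg: "degree P = degree Q"
    using min_length_le[OF nz(1) assms(3)] min_length_le[OF nz(2) assms(6)] assms(2,5)
    by (simp add: coeff_length_def)
  have "coeff (P - Q) (degree P) = 0" using assms(1,4) deg by simp
  then have "degree (P - Q) \<noteq> degree P"
    using \<open>P \<noteq> Q\<close> by (metis leading_coeff_0_iff right_minus_eq)
  then have "degree (P - Q) < degree P"
    using degree_diff_le_max[of P Q] deg by simp
  moreover have "min_length a n \<le> coeff_length (P - Q)"
    using \<open>P \<noteq> Q\<close> common_denom_diff[OF assms(3,6)] by (intro min_length_le) auto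
  ultimately show False using assms(2) by (simp add: coeff_length_def)
qed

lemma min_denom_eqI:
  assumes "lead_coeff Q = 1" "degree Q < min_length a n" "common_denom a n Q"
  shows "min_denom a n = Q"
  unfolding min_denom_def all_cancel_length_ge_iff
  using assms monic_min_denom_unique by (intro the_equality) blast+

lemma
  fixes a :: "'r::finite \<Rightarrow> 'a::{field,finite} fls"
  shows lead_coeff_min_denom: "lead_coeff (min_denom a n) = 1"
    and coeff_length_min_denom: "coeff_length (min_denom a n) = min_length a n"
    and common_denom_min_denom: "common_denom a n (min_denom a n)"
proof -
  obtain Q where Q: "Q \<noteq> 0" "coeff_length Q = min_length a n" "common_denom a n Q"
    by (rule min_length_attained)
  define P where "P = smult (inverse (lead_coeff Q)) Q"
  have P: "lead_coeff P = 1" "coeff_length P = min_length a n" "common_denom a n P"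
    using Q by (auto simp: P_def coeff_length_def common_denom_smult)
  then have "min_denom a n = P"
    by (intro min_denom_eqI) (auto simp: coeff_length_def)
  with P show "lead_coeff (min_denom a n) = 1"
    "coeff_length (min_denom a n) = min_length a n" "common_denom a n (min_denom a n)"
    by simp_all
qed

lemma min_denom_nonzero:
  fixes a :: "'r::finite \<Rightarrow> 'a::{field,finite} fls"
  shows "min_denom a n \<noteq> 0"
  using lead_coeff_min_denom[of a n] by auto

lemma min_length_mono:
  fixes a :: "'r::finite \<Rightarrow> 'a::{field,finite} fls"
  shows "min_length a n \<le> min_length a (Suc n)"
  by (metis min_length_attained min_length_le common_denom_Suc_imp)

lemma residual_eq_0_iff:
  fixes a :: "'r::finite \<Rightarrow> 'a::{field,finite} fls"
  shows "residual a n = 0 \<longleftrightarrow> common_denom a (Suc n) (min_denom a n)"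
proof -
  have "{1..Suc n} = insert (Suc n) {1..n}" by auto
  then have "common_denom a (Suc n) (min_denom a n) \<longleftrightarrow>
      (\<forall>i. coeff_t (poly_to_K (min_denom a n) * a i) (- int (Suc n)) = 0)"
    using common_denom_min_denom[of a n] by (auto simp: common_denom_def simp del: of_nat_Suc)
  then show ?thesis
    by (simp add: residual_def vec_eq_iff add.commute)
qed

text \<open>
  If the length does not grow, \<^term>\<open>min_denom a (Suc n)\<close> is a monic minimal denominator for \<open>n\<close> as
  well, so by uniqueness it is \<^term>\<open>min_denom a n\<close>.
\<close>
lemma jump_eq_residual:
  fixes a :: "'r::finite \<Rightarrow> 'a::{field,finite} fls"
  shows "jump a n = of_bool (residual a n \<noteq> 0)"
proof -
  have "residual a n = 0 \<longleftrightarrow> min_length a (Suc n) = min_length a n"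
  proof
    assume "residual a n = 0"
    then have "min_length a (Suc n) \<le> coeff_length (min_denom a n)"
      by (intro min_length_le min_denom_nonzero) (simp add: residual_eq_0_iff)
    then show "min_length a (Suc n) = min_length a n"
      using min_length_mono[of a n] by (simp add: coeff_length_min_denom)
  next
    assume "min_length a (Suc n) = min_length a n"
    then have "min_denom a n = min_denom a (Suc n)"
      using coeff_length_min_denom[of a "Suc n"] lead_coeff_min_denom[of a "Suc n"]
        common_denom_Suc_imp[OF common_denom_min_denom]
      by (intro min_denom_eqI) (auto simp: coeff_length_def)
    then show "residual a n = 0"
      by (simp add: residual_eq_0_iff common_denom_min_denom)
  qed
  then show ?thesis
    using min_length_mono[of a n] by (auto simp: jump_def)
qed

section \<open>Which coefficients are read\<close>

definition agree_upto :: "nat \<Rightarrow> ('r \<Rightarrow> 'a::field fls) \<Rightarrow> ('r \<Rightarrow> 'a fls) \<Rightarrow> bool" where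
  "agree_upto K a b \<longleftrightarrow> (\<forall>i. \<forall>k\<in>{1..K}. coeff_t (a i) (- int k) = coeff_t (b i) (- int k))"

text \<open>
  The index of the last coefficient that is inspected when \<^term>\<open>min_denom a n\<close> is verified to be a
  common denominator.
\<close>
definition horizon :: "('r \<Rightarrow> 'a::field fls) \<Rightarrow> nat \<Rightarrow> nat" where
  "horizon a n = n + degree (min_denom a n)"

lemma agree_upto_sym: "agree_upto K a b \<Longrightarrow> agree_upto K b a"
  by (auto simp: agree_upto_def)

lemma agree_upto_mono: "agree_upto K a b \<Longrightarrow> L \<le> K \<Longrightarrow> agree_upto L a b"
  by (auto simp: agree_upto_def)

lemma coeff_t_mult_cong:
  assumes "agree_upto K a b" "k \<ge> 1" "k + degree Q \<le> K"
  shows "coeff_t (poly_to_K Q * a i) (- int k) = coeff_t (poly_to_K Q * b i) (- int k)"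
  unfolding coeff_t_poly_to_K_mult[OF order_refl]
proof (intro sum.cong refl)
  fix j assume "j \<in> {..degree Q}"
  then have "coeff_t (a i) (- int (k + j)) = coeff_t (b i) (- int (k + j))"
    using assms by (simp add: agree_upto_def del: of_nat_add)
  then show "coeff Q j * coeff_t (a i) (- int k - int j) = coeff Q j * coeff_t (b i) (- int k - int j)"
    by simp
qed

lemma common_denom_cong:
  assumes "agree_upto K a b" "n + degree Q \<le> K"
  shows "common_denom a n Q \<longleftrightarrow> common_denom b n Q"
  unfolding common_denom_def using coeff_t_mult_cong[OF assms(1)] assms(2) by auto

text \<open>
  Rejecting the polynomials of degree below that of \<^term>\<open>min_denom a n\<close> takes even fewer coefficients
  than accepting this one, so coefficients beyond the horizon of \<open>a\<close> have no influence. Only the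
  horizon of one of the two tuples is bounded; that of the other one follows.
\<close>
lemma min_denom_cong:
  fixes a b :: "'r::finite \<Rightarrow> 'a::{field,finite} fls"
  assumes agree: "agree_upto K a b" and K: "horizon a n \<le> K"
  shows "min_denom b n = min_denom a n"
proof (rule min_denom_eqI)
  show "lead_coeff (min_denom a n) = 1" by (rule lead_coeff_min_denom)
  show "common_denom b n (min_denom a n)"
    using common_denom_cong[OF agree] common_denom_min_denom[of a n] K
    by (auto simp: horizon_def)
  obtain Q where Q: "Q \<noteq> 0" "coeff_length Q = min_length b n" "common_denom b n Q"
    by (rule min_length_attained)
  show "degree (min_denom a n) < min_length b n"
  proof (rule ccontr)
    assume "\<not> ?thesis"
    then have less: "coeff_length Q \<le> degree (min_denom a n)" using Q by simp
    then have "common_denom a n Q"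
      using Q common_denom_cong[OF agree, of n Q] K by (auto simp: horizon_def coeff_length_def)
    then have "min_length a n \<le> coeff_length Q" using Q by (intro min_length_le)
    with less show False
      using coeff_length_min_denom[of a n] by (simp add: coeff_length_def)
  qed
qed

text \<open>The horizon is a stopping time: the event that it equals \<open>m\<close> is decided by the first \<open>m\<close> coefficients.\<close>
lemma horizon_cong:
  fixes a b :: "'r::finite \<Rightarrow> 'a::{field,finite} fls"
  assumes "agree_upto m a b"
  shows "horizon a n = m \<longleftrightarrow> horizon b n = m"
  using min_denom_cong[OF assms, of n] min_denom_cong[OF agree_upto_sym[OF assms], of n]
  by (auto simp: horizon_def)

lemma residual_cong:
  fixes a b :: "'r::finite \<Rightarrow> 'a::{field,finite} fls"
  assumes agree: "agree_upto K a b" and K: "horizon a n < K"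
  shows "residual a n = residual b n"
proof -
  have "min_denom b n = min_denom a n"
    using assms by (intro min_denom_cong) auto
  then show ?thesis
    using coeff_t_mult_cong[OF agree, of "Suc n" "min_denom a n"] K
    by (simp add: residual_def vec_eq_iff horizon_def algebra_simps)
qed

text \<open>
  This makes the first coefficient past the horizon fresh: with \<open>residual_cong\<close>, the
  residuals with index below \<open>n\<close> read nothing beyond \<^term>\<open>horizon a n\<close>.
\<close>
lemma strict_mono_horizon:
  fixes a :: "'r::finite \<Rightarrow> 'a::{field,finite} fls"
  shows "strict_mono (horizon a)"
proof (rule strict_monoI_Suc)
  fix n
  show "horizon a n < horizon a (Suc n)"
    using min_length_mono[of a n] coeff_length_min_denom[of a n] coeff_length_min_denom[of a "Suc n"]
    by (simp add: horizon_def coeff_length_def)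
qed

section \<open>Perturbing one coefficient\<close>

definition single_coeff :: "nat \<Rightarrow> 'a::field ^ 'r \<Rightarrow> 'r \<Rightarrow> 'a fls" where
  "single_coeff k c i = fls_shift (- int k) (fls_const (vec_nth c i))"

lemma coeff_t_single_coeff:
  "coeff_t (single_coeff k c i) m = (if m = - int k then vec_nth c i else 0)"
  by (auto simp: single_coeff_def coeff_t_def)

lemma single_coeff_in_frac_series:
  "k \<ge> 1 \<Longrightarrow> single_coeff k c i \<in> frac_series"
  by (simp add: frac_series_def coeff_t_single_coeff)

lemma coeff_t_add: "coeff_t (x + y) m = coeff_t x m + coeff_t y m"
  by (simp add: coeff_t_def)

lemma agree_upto_single_coeff:
  "agree_upto m a (\<lambda>i. single_coeff (Suc m) c i + a i)"
  by (auto simp: agree_upto_def coeff_t_add coeff_t_single_coeff)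

text \<open>
  The coefficient just past the horizon meets only the leading coefficient of \<^term>\<open>min_denom a n\<close>,
  which is \<open>1\<close>, so it enters the residual additively.
\<close>
lemma residual_add_single_coeff:
  fixes a :: "'r::finite \<Rightarrow> 'a::{field,finite} fls"
  assumes m: "horizon a n = m"
  shows "residual (\<lambda>i. single_coeff (Suc m) c i + a i) n = c + residual a n"
proof -
  define Q where "Q = min_denom a n"
  have Q': "min_denom (\<lambda>i. single_coeff (Suc m) c i + a i) n = Q"
    unfolding Q_def using agree_upto_single_coeff m by (intro min_denom_cong) auto
  have "coeff_t (poly_to_K Q * (single_coeff (Suc m) c i)) (- (int n + 1)) = vec_nth c i" for i
  proof -
    have "coeff_t (poly_to_K Q * (single_coeff (Suc m) c i)) (- (int n + 1)) =
        (\<Sum>j\<le>degree Q. if j = degree Q then coeff Q j * vec_nth c i else 0)"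
      unfolding coeff_t_poly_to_K_mult[OF order_refl]
      by (intro sum.cong) (use m in \<open>auto simp: coeff_t_single_coeff horizon_def Q_def\<close>)
    also have "\<dots> = vec_nth c i"
      using lead_coeff_min_denom[of a n] by (simp add: Q_def)
    finally show ?thesis .
  qed
  then show ?thesis
    by (simp add: residual_def Q' vec_eq_iff distrib_left coeff_t_add flip: Q_def)
qed

section \<open>Measurability\<close>

text \<open>
  For \<open>k \<ge> 0\<close>, two series at distance less than \<open>2\<^sup>-\<^sup>k\<close> agree up to and including index \<open>k\<close>; for
  negative \<open>k\<close> the radius \<open>1\<close> is small enough.
\<close>
lemma open_fls_nth: "open {x :: 'a::field fls. fls_nth x k = c}"
  unfolding open_fls_def
proof (intro ballI exI conjI subsetI)
  fix x y :: "'a fls" 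
  assume x: "x \<in> {x. fls_nth x k = c}"
    and y: "y \<in> {y. dist y x < inverse (2 ^ nat k)}"
  show "y \<in> {x. fls_nth x k = c}"
  proof (cases "y = x")
    case False
    have "k < fls_subdegree (y - x)"
    proof (cases "fls_subdegree (y - x) \<ge> 0")
      case True
      then have "(2::real) ^ nat k < 2 ^ nat (fls_subdegree (y - x))"
        using y False by (simp add: dist_fls_def)
      then have "nat k < nat (fls_subdegree (y - x))" by simp
      then show ?thesis by linarith
    next
      case nonneg: False
      have "inverse (2 ^ nat k) \<le> (1::real)"
        by (simp add: field_simps)
      moreover have "(1::real) \<le> 2 ^ nat (- fls_subdegree (y - x))" by simp
      moreover have "2 ^ nat (- fls_subdegree (y - x)) < inverse ((2::real) ^ nat k)"
        using y False nonneg by (simp add: dist_fls_def)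
      ultimately have False by linarith
      then show ?thesis ..
    qed
    then have "fls_nth (y - x) k = 0" by (rule fls_eq0_below_subdegree)
    with x show ?thesis by simp
  qed (use x in simp)
qed simp

lemma space_frac_borel: "space frac_borel = frac_series"
  by (simp add: frac_borel_def space_restrict_space)

lemma sets_frac_borel_coeff:
  "{x \<in> space frac_borel. coeff_t x m = (c::'a::field)} \<in> sets frac_borel"
proof -
  have "{x :: 'a fls. fls_nth x (- m) = c} \<in> sets borel"
    using open_fls_nth by (rule borel_open)
  then have "frac_series \<inter> {x :: 'a fls. fls_nth x (- m) = c} \<in> sets frac_borel"
    unfolding frac_borel_def by (auto simp: sets_restrict_space)
  then show ?thesis
    by (simp add: space_frac_borel coeff_t_def Int_def)
qed

lemma measurable_add_frac_borel:
  fixes y :: "'a::field fls"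
  assumes "y \<in> frac_series"
  shows "(+) y \<in> frac_borel \<rightarrow>\<^sub>M frac_borel"
proof -
  have "continuous_on UNIV ((+) y)"
    unfolding continuous_on_iff by (auto simp: dist_fls_def)
  then have "(+) y \<in> borel \<rightarrow>\<^sub>M borel"
    by (rule borel_measurable_continuous_onI)
  moreover have "y + x \<in> frac_series" if "x \<in> frac_series" for x
    using that assms by (simp add: frac_series_def coeff_t_add)
  ultimately show ?thesis
    unfolding frac_borel_def
    by (intro measurable_restrict_space3) auto
qed

abbreviation frac_tuples :: "('r \<Rightarrow> 'a::field fls) measure" where
  "frac_tuples \<equiv> \<Pi>\<^sub>M i\<in>UNIV. frac_borel"

text \<open>
  A property decided by finitely many coefficients over a finite field is a finite union of
  cylinders; it is expressed as stability under agreement, so that no explicit formula for minimal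
  denominators is needed to see that events about them are measurable.
\<close>
lemma finite_window_in_sets:
  fixes P :: "('r::finite \<Rightarrow> 'a::{field,finite} fls) \<Rightarrow> bool"
  assumes P: "\<And>a b. agree_upto K a b \<Longrightarrow> P a \<Longrightarrow> P b"
  shows "{a \<in> space frac_tuples. P a} \<in> sets frac_tuples"
proof -
  define W where "W = (UNIV :: 'r set) \<times> {1..K}"
  (* T a tabulates the window of a; the set in question is the union of the fibres of T over the
     tables that satisfy P. *)
  define T where "T a = (\<lambda>(i, k)\<in>W. coeff_t (a i) (- int k))" for a :: "'r \<Rightarrow> 'a fls"
  have fin: "finite (W \<rightarrow>\<^sub>E (UNIV :: 'a set))"
    by (intro finite_PiE) (auto simp: W_def)
  have T_eq: "T a = f \<longleftrightarrow> (\<forall>p\<in>W. coeff_t (a (fst p)) (- int (snd p)) = f p)"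
    if "f \<in> W \<rightarrow>\<^sub>E UNIV" for a f
    using that by (auto simp: T_def fun_eq_iff restrict_def PiE_def extensional_def)
  have "{a \<in> space frac_tuples. T a = f} \<in> sets frac_tuples" if f: "f \<in> W \<rightarrow>\<^sub>E UNIV" for f
  proof -
    have "{a \<in> space frac_tuples. coeff_t (a (fst p)) (- int (snd p)) = f p} \<in> sets frac_tuples" for p
    proof -
      have "(\<lambda>a. a (fst p)) -` {x \<in> space frac_borel. coeff_t x (- int (snd p)) = f p} \<inter> space frac_tuples
          \<in> sets frac_tuples"
        by (intro measurable_sets[OF _ sets_frac_borel_coeff] measurable_component_singleton) simp
      also have "(\<lambda>a. a (fst p)) -` {x \<in> space frac_borel. coeff_t x (- int (snd p)) = f p} \<inter> space frac_tuples
          = {a \<in> space frac_tuples. coeff_t (a (fst p)) (- int (snd p)) = f p}"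
        by (auto simp: space_PiM)
      finally show ?thesis .
    qed
    then have "{a \<in> space frac_tuples. \<forall>p\<in>W. coeff_t (a (fst p)) (- int (snd p)) = f p} \<in> sets frac_tuples"
      by (intro sets.sets_Collect_finite_All) (auto simp: W_def)
    with f show ?thesis by (simp add: T_eq)
  qed
  then have "(\<Union>f\<in>{f \<in> W \<rightarrow>\<^sub>E UNIV. \<exists>b. T b = f \<and> P b}. {a \<in> space frac_tuples. T a = f})
      \<in> sets frac_tuples"
    by (intro sets.finite_UN) (auto intro: finite_subset[OF _ fin])
  also have "(\<Union>f\<in>{f \<in> W \<rightarrow>\<^sub>E UNIV. \<exists>b. T b = f \<and> P b}. {a \<in> space frac_tuples. T a = f})
      = {a \<in> space frac_tuples. P a}"
  proof -
    have "agree_upto K b a" if "T a = T b" for a b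
      using that unfolding agree_upto_def
      by (auto simp: T_def W_def fun_eq_iff restrict_def split: if_splits)
    then have "P a" if "T a = T b" "P b" for a b using that P by blast
    moreover have "T a \<in> W \<rightarrow>\<^sub>E UNIV" for a by (auto simp: T_def)
    ultimately show ?thesis by (auto dest: sym)
  qed
  finally show ?thesis .
qed

section \<open>Random tuples\<close>

locale haar_tuple = prob_space M for M :: "'w measure" +
  fixes \<alpha> :: "'r::finite \<Rightarrow> 'w \<Rightarrow> 'a::{field,finite} fls"
  assumes indep: "indep_vars (\<lambda>_. frac_borel) \<alpha> UNIV"
    and haar: "\<And>i. haar_prob (distr M frac_borel (\<alpha> i))"
begin

lemma coordinate_measurable: "\<alpha> i \<in> M \<rightarrow>\<^sub>M frac_borel"
  using indep by (auto simp: indep_vars_def)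

lemma tuple_measurable: "(\<lambda>\<omega> i. \<alpha> i \<omega>) \<in> M \<rightarrow>\<^sub>M frac_tuples"
  using measurable_restrict[of UNIV \<alpha> M "\<lambda>_. frac_borel"] coordinate_measurable by (simp add: restrict_UNIV)

lemma distr_translate:
  assumes y: "y \<in> frac_series"
  shows "distr M frac_borel (\<lambda>\<omega>. y + \<alpha> i \<omega>) = distr M frac_borel (\<alpha> i)"
proof -
  let ?\<mu> = "distr M frac_borel (\<alpha> i)"
  have my: "- y \<in> frac_series"
    using y by (simp add: frac_series_def coeff_t_def)
  have "distr M frac_borel (\<lambda>\<omega>. y + \<alpha> i \<omega>) = distr ?\<mu> frac_borel ((+) y)"
    using distr_distr[OF measurable_add_frac_borel[OF y] coordinate_measurable] by (simp add: comp_def)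
  also have "\<dots> = ?\<mu>"
  proof (rule measure_eqI)
    fix A assume "A \<in> sets (distr ?\<mu> frac_borel ((+) y))"
    then have A: "A \<in> sets frac_borel" by simp
    have "A \<subseteq> frac_series" using sets.sets_into_space[OF A] by (simp add: space_frac_borel)
    have closed: "- y + x \<in> frac_series" if "x \<in> frac_series" for x
      using that my by (simp add: frac_series_def coeff_t_def)
    have "(+) y -` A \<inter> frac_series = (+) (- y) ` A"
    proof (intro set_eqI iffI)
      fix x assume "x \<in> (+) y -` A \<inter> frac_series"
      then show "x \<in> (+) (- y) ` A" by (intro image_eqI[of _ _ "y + x"]) auto
    next
      fix x assume "x \<in> (+) (- y) ` A"
      then show "x \<in> (+) y -` A \<inter> frac_series" using \<open>A \<subseteq> frac_series\<close> closed by auto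
    qed
    then have "emeasure (distr ?\<mu> frac_borel ((+) y)) A = emeasure ?\<mu> ((+) (- y) ` A)"
      using A measurable_add_frac_borel[OF y]
      by (subst emeasure_distr) (auto simp: space_frac_borel)
    also have "\<dots> = emeasure ?\<mu> A"
      using haar[of i] my A unfolding haar_prob_def by (metis sets_distr)
    finally show "emeasure (distr ?\<mu> frac_borel ((+) y)) A = emeasure ?\<mu> A" .
  qed simp
  finally show ?thesis .
qed

text \<open>
  Translation acts on each coordinate separately, so it preserves independence as well as the
  marginals, and these two determine the joint law.
\<close>
lemma prob_translate:
  assumes y: "\<And>i. y i \<in> frac_series" and A: "A \<in> sets frac_tuples"
  shows "\<P>(\<omega> in M. (\<lambda>i. y i + \<alpha> i \<omega>) \<in> A) = \<P>(\<omega> in M. (\<lambda>i. \<alpha> i \<omega>) \<in> A)"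
proof -
  let ?\<beta> = "\<lambda>i \<omega>. y i + \<alpha> i \<omega>"
  have coordinate_measurable': "?\<beta> i \<in> M \<rightarrow>\<^sub>M frac_borel" for i
    using measurable_compose[OF coordinate_measurable measurable_add_frac_borel[OF y]] .
  have tuple': "(\<lambda>\<omega> i. ?\<beta> i \<omega>) \<in> M \<rightarrow>\<^sub>M frac_tuples"
    using measurable_restrict[of UNIV ?\<beta> M "\<lambda>_. frac_borel"] coordinate_measurable' by (simp add: restrict_UNIV)
  have "indep_vars (\<lambda>_. frac_borel) ?\<beta> UNIV"
    using indep_vars_compose2[OF indep measurable_add_frac_borel[OF y]] .
  then have "distr M frac_tuples (\<lambda>\<omega> i. ?\<beta> i \<omega>) = distr M frac_tuples (\<lambda>\<omega> i. \<alpha> i \<omega>)"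
    using indep_vars_iff_distr_eq_PiM[of UNIV ?\<beta> "\<lambda>_. frac_borel"] coordinate_measurable' indep
      indep_vars_iff_distr_eq_PiM[of UNIV \<alpha> "\<lambda>_. frac_borel"] coordinate_measurable
    by (simp add: restrict_UNIV distr_translate[OF y])
  then have "measure (distr M frac_tuples (\<lambda>\<omega> i. ?\<beta> i \<omega>)) A
      = measure (distr M frac_tuples (\<lambda>\<omega> i. \<alpha> i \<omega>)) A"
    by simp
  then show ?thesis
    using A by (simp add: measure_distr tuple' tuple_measurable vimage_def Int_def conj_commute)
qed

abbreviation res :: "nat \<Rightarrow> 'w \<Rightarrow> 'a ^ 'r" where
  "res n \<omega> \<equiv> residual (\<lambda>i. \<alpha> i \<omega>) n"

text \<open>
  Translating by \<open>v\<close> at position \<open>m + 1\<close> carries the event with \<open>\<rho>\<^sub>n = 0\<close> onto the event with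
  \<open>\<rho>\<^sub>n = v\<close>. Fixing the horizon makes the translation the same for all sample points, as
  invariance requires.
\<close>
lemma prob_res_at_horizon:
  fixes n :: nat and A :: "nat \<Rightarrow> ('a ^ 'r) set" and v :: "'a ^ 'r"
  defines "E \<equiv> \<lambda>m v. {\<omega> \<in> space M. horizon (\<lambda>i. \<alpha> i \<omega>) n = m \<and> (\<forall>k<n. res k \<omega> \<in> A k) \<and> res n \<omega> = v}"
  shows "E m v \<in> events" and "prob (E m v) = prob (E m 0)"
proof -
  define P where "P v a \<longleftrightarrow> horizon a n = m \<and> (\<forall>k<n. residual a k \<in> A k) \<and> residual a n = v"
    for v and a :: "'r \<Rightarrow> 'a fls"
  define S where "S v = {a \<in> space frac_tuples. P v a}" for v
  have horizon_less: "horizon a k < horizon a n" if "k < n" for k and a :: "'r \<Rightarrow> 'a fls"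
    using strict_mono_horizon that by (rule strict_monoD)
  have S: "S v \<in> sets frac_tuples" for v
    unfolding S_def
  proof (rule finite_window_in_sets)
    fix a b :: "'r \<Rightarrow> 'a fls"
    assume agree: "agree_upto (Suc m) a b" and a: "P v a"
    have "horizon b n = m"
      using a horizon_cong[OF agree_upto_mono[OF agree], of m n] by (auto simp: P_def)
    moreover have "residual a k = residual b k" if "k \<le> n" for k
      using that a horizon_less[of k a]
      by (intro residual_cong[OF agree]) (auto simp: P_def le_less)
    ultimately show "P v b" using a by (simp add: P_def)
  qed
  have "E m v = (\<lambda>\<omega> i. \<alpha> i \<omega>) -` S v \<inter> space M"
    using measurable_space[OF tuple_measurable] by (auto simp: E_def S_def P_def)
  then show "E m v \<in> events"
    using measurable_sets[OF tuple_measurable S] by simp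
  have shift: "P v (\<lambda>i. single_coeff (Suc m) v i + a i) \<longleftrightarrow> P 0 a" for a
  proof -
    let ?b = "\<lambda>i. single_coeff (Suc m) v i + a i"
    have agree: "agree_upto m a ?b" by (rule agree_upto_single_coeff)
    have hor: "horizon ?b n = m \<longleftrightarrow> horizon a n = m"
      using horizon_cong[OF agree] by blast
    show ?thesis
    proof (cases "horizon a n = m")
      case True
      have "residual ?b k = residual a k" if "k < n" for k
        using residual_cong[OF agree, of k] horizon_less[OF that, of a] True by simp
      then show ?thesis
        using True hor residual_add_single_coeff[OF True, of v] by (auto simp: P_def)
    qed (use hor in \<open>simp add: P_def\<close>)
  qed
  have frac: "single_coeff (Suc m) v i \<in> frac_series" for i
    by (rule single_coeff_in_frac_series) simp
  have in_space: "(\<lambda>i. \<alpha> i \<omega>) \<in> space frac_tuples"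
    "(\<lambda>i. single_coeff (Suc m) v i + \<alpha> i \<omega>) \<in> space frac_tuples" if "\<omega> \<in> space M" for \<omega>
    using measurable_space[OF measurable_add_frac_borel[OF frac]] measurable_space[OF coordinate_measurable that]
    by (auto simp: space_PiM)
  have "prob (E m v) = \<P>(\<omega> in M. (\<lambda>i. \<alpha> i \<omega>) \<in> S v)"
    using in_space by (intro arg_cong[where f = prob]) (auto simp: E_def S_def P_def)
  also have "\<dots> = \<P>(\<omega> in M. (\<lambda>i. single_coeff (Suc m) v i + \<alpha> i \<omega>) \<in> S v)"
    using prob_translate[OF frac S] by simp
  also have "\<dots> = prob (E m 0)"
    using in_space shift by (intro arg_cong[where f = prob]) (auto simp: E_def S_def P_def)
  finally show "prob (E m v) = prob (E m 0)" .
qed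

text \<open>The horizon takes countably many values, so it can be summed out.\<close>
lemma prob_res_with_history:
  fixes n :: nat and A :: "nat \<Rightarrow> ('a ^ 'r) set" and v :: "'a ^ 'r"
  defines "E \<equiv> \<lambda>v. {\<omega> \<in> space M. (\<forall>k<n. res k \<omega> \<in> A k) \<and> res n \<omega> = v}"
  shows "E v \<in> events" and "prob (E v) = prob (E 0)"
proof -
  define F where
    "F v m = {\<omega> \<in> space M. horizon (\<lambda>i. \<alpha> i \<omega>) n = m \<and> (\<forall>k<n. res k \<omega> \<in> A k) \<and> res n \<omega> = v}"
    for v m
  have E: "E v = (\<Union>m. F v m)" for v
    by (auto simp: E_def F_def)
  have F: "range (F v) \<subseteq> events" "disjoint_family (F v)" for v
    using prob_res_at_horizon(1) by (auto simp: F_def disjoint_family_on_def)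
  show "E v \<in> events"
    unfolding E using F by auto
  have "(\<lambda>m. prob (F v m)) sums prob (E v)" for v
    unfolding E by (rule finite_measure_UNION[OF F])
  moreover have "prob (F v m) = prob (F 0 m)" for m
    unfolding F_def by (rule prob_res_at_horizon(2))
  ultimately show "prob (E v) = prob (E 0)"
    by (metis (no_types, lifting) sums_cong sums_unique2)
qed

lemma res_measurable: "res n \<in> M \<rightarrow>\<^sub>M count_space UNIV"
proof -
  have "res n -` {v} \<inter> space M \<in> events" for v
    using prob_res_with_history(1)[where n = n and A = "\<lambda>_. UNIV" and v = v]
    by (simp add: vimage_def Int_def conj_commute)
  then show ?thesis by (simp add: measurable_count_space_eq2_countable)
qed

text \<open>
  Arbitrary sets \<^term>\<open>A k\<close> are allowed, so that choosing \<^term>\<open>UNIV\<close> for some indices turns this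
  into a formula for any finite set of residuals.
\<close>
lemma prob_res_history:
  "\<P>(\<omega> in M. \<forall>k<n. res k \<omega> \<in> A k) = (\<Prod>k<n. card (A k) / CARD('a ^ 'r))"
proof (induction n)
  case 0
  then show ?case by (simp add: prob_space)
next
  case (Suc n)
  define E where "E v = {\<omega> \<in> space M. (\<forall>k<n. res k \<omega> \<in> A k) \<and> res n \<omega> = v}" for v
  have E: "E v \<in> events" "prob (E v) = prob (E 0)" for v
    unfolding E_def by (rule prob_res_with_history)+
  have union: "prob (\<Union>v\<in>V. E v) = card V * prob (E 0)" for V
  proof -
    have "prob (\<Union>v\<in>V. E v) = (\<Sum>v\<in>V. prob (E v))"
      by (rule finite_measure_finite_Union) (auto simp: E disjoint_family_on_def, auto simp: E_def)
    also have "\<dots> = (\<Sum>v\<in>V. prob (E 0))"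
      by (intro sum.cong refl E(2))
    also have "\<dots> = card V * prob (E 0)"
      by simp
    finally show ?thesis .
  qed
  have "{\<omega> \<in> space M. \<forall>k<Suc n. res k \<omega> \<in> A k} = (\<Union>v\<in>A n. E v)"
    by (auto simp: E_def less_Suc_eq)
  moreover have "{\<omega> \<in> space M. \<forall>k<n. res k \<omega> \<in> A k} = (\<Union>v\<in>UNIV. E v)"
    by (auto simp: E_def)
  ultimately show ?case
    using union[of "A n"] union[of UNIV] Suc.IH by (simp add: field_simps)
qed

lemma prob_res_in: "\<P>(\<omega> in M. res n \<omega> \<in> V) = card V / CARD('a ^ 'r)"
proof -
  define A where "A k = (if k = n then V else UNIV)" for k
  have "\<P>(\<omega> in M. res n \<omega> \<in> V) = \<P>(\<omega> in M. \<forall>k<Suc n. res k \<omega> \<in> A k)"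
    by (intro arg_cong[where f = prob]) (auto simp: A_def)
  also have "\<dots> = (\<Prod>k<Suc n. card (A k) / CARD('a ^ 'r))"
    by (rule prob_res_history)
  also have "\<dots> = card V / CARD('a ^ 'r)"
    by (simp add: A_def)
  finally show ?thesis .
qed

lemma indep_res: "indep_vars (\<lambda>_. count_space UNIV) res UNIV"
  unfolding indep_vars_def2
proof (intro conjI ballI indep_setsI res_measurable)
  fix i show "{res i -` A \<inter> space M |A. A \<in> sets (count_space UNIV)} \<subseteq> events"
    using measurable_sets[OF res_measurable] by auto
next
  fix B and J :: "nat set"
  assume J: "J \<noteq> {}" "finite J"
    and B: "\<forall>j\<in>J. B j \<in> {res j -` A \<inter> space M |A. A \<in> sets (count_space UNIV)}"
  from B obtain V where V: "\<And>j. j \<in> J \<Longrightarrow> B j = res j -` V j \<inter> space M"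
    by simp metis
  define A where "A k = (if k \<in> J then V k else UNIV)" for k
  define n where "n = Suc (Max J)"
  have n: "J \<subseteq> {..<n}" using J by (auto simp: n_def less_Suc_eq_le)
  have "(\<Inter>j\<in>J. B j) = {\<omega> \<in> space M. \<forall>k<n. res k \<omega> \<in> A k}"
    using V n J(1) by (auto simp: A_def)
  then have "prob (\<Inter>j\<in>J. B j) = (\<Prod>k<n. card (A k) / CARD('a ^ 'r))"
    by (simp add: prob_res_history)
  also have "\<dots> = (\<Prod>k\<in>J. card (A k) / CARD('a ^ 'r))"
    using n by (intro prod.mono_neutral_right) (auto simp: A_def)
  also have "\<dots> = (\<Prod>j\<in>J. prob (B j))"
  proof (intro prod.cong refl)
    fix j assume j: "j \<in> J"
    then have "B j = {\<omega> \<in> space M. res j \<omega> \<in> V j}" using V by auto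
    then show "card (A j) / CARD('a ^ 'r) = prob (B j)"
      using j prob_res_in[of j "V j"] by (simp add: A_def)
  qed
  finally show "prob (\<Inter>j\<in>J. B j) = (\<Prod>j\<in>J. prob (B j))" .
qed

lemma distr_res: "distr M (count_space UNIV) (res n) = uniform_count_measure UNIV"
proof (rule measure_eqI)
  fix A :: "('a ^ 'r) set"
  have "emeasure (distr M (count_space UNIV) (res n)) A = prob {\<omega> \<in> space M. res n \<omega> \<in> A}"
    by (subst emeasure_distr[OF res_measurable])
      (auto simp: emeasure_eq_measure vimage_def Int_def conj_commute)
  then show "emeasure (distr M (count_space UNIV) (res n)) A = emeasure (uniform_count_measure UNIV) A"
    by (simp add: prob_res_in emeasure_uniform_count_measure)
qed (simp add: sets_uniform_count_measure)

lemma prob_res_nonzero: "\<P>(\<omega> in M. res n \<omega> \<noteq> 0) = 1 - 1 / CARD('a ^ 'r)"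
proof -
  have "\<P>(\<omega> in M. res n \<omega> \<in> UNIV - {0}) = 1 - 1 / CARD('a ^ 'r)"
    unfolding prob_res_in by (simp add: card_Diff_singleton field_simps)
  then show ?thesis by simp
qed

lemma distr_nonzero_res:
  "distr M (count_space UNIV) (\<lambda>\<omega>. of_bool (res n \<omega> \<noteq> 0)) =
    measure_pmf (map_pmf of_bool (bernoulli_pmf (1 - 1 / CARD('a ^ 'r))) :: nat pmf)"
proof -
  define p where "p = 1 - 1 / real CARD('a ^ 'r)"
  have p: "0 \<le> p" "p \<le> 1" by (auto simp: p_def divide_le_eq)
  have meas: "(\<lambda>\<omega>. res n \<omega> \<noteq> 0) \<in> M \<rightarrow>\<^sub>M count_space UNIV"
    by (rule measurable_compose[OF res_measurable]) simp
  have "distr M (count_space UNIV) (\<lambda>\<omega>. res n \<omega> \<noteq> 0) = measure_pmf (bernoulli_pmf p)"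
  proof (rule measure_eqI_countable[where A = UNIV])
    fix b :: bool
    have "emeasure (distr M (count_space UNIV) (\<lambda>\<omega>. res n \<omega> \<noteq> 0)) {b}
        = prob {\<omega> \<in> space M. (res n \<omega> \<noteq> 0) = b}"
      by (subst emeasure_distr[OF meas])
        (auto simp: emeasure_eq_measure vimage_def Int_def conj_commute)
    also have "prob {\<omega> \<in> space M. (res n \<omega> \<noteq> 0) = b} = pmf (bernoulli_pmf p) b"
      using prob_res_nonzero[of n] prob_res_in[of n "{0}"] p
      by (cases b) (simp_all add: p_def)
    also have "ennreal (pmf (bernoulli_pmf p) b) = emeasure (measure_pmf (bernoulli_pmf p)) {b}"
      by (simp add: emeasure_pmf_single)
    finally show "emeasure (distr M (count_space UNIV) (\<lambda>\<omega>. res n \<omega> \<noteq> 0)) {b}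
        = emeasure (measure_pmf (bernoulli_pmf p)) {b}" .
  qed auto
  then have "distr (distr M (count_space UNIV) (\<lambda>\<omega>. res n \<omega> \<noteq> 0)) (count_space UNIV) of_bool
      = measure_pmf (map_pmf of_bool (bernoulli_pmf p) :: nat pmf)"
    by (simp add: map_pmf_rep_eq)
  then show ?thesis
    using meas by (simp add: distr_distr comp_def p_def)
qed

end

section \<open>Projective classes\<close>

lemma equiv_proj_rel: "equiv (UNIV - {0}) (proj_rel :: (('a::field ^ 'r) \<times> ('a ^ 'r)) set)"
proof (rule equivI)
  show "refl_on (UNIV - {0}) (proj_rel :: (('a ^ 'r) \<times> ('a ^ 'r)) set)"
    by (auto simp: refl_on_def proj_rel_def intro: exI[of _ 1])
  show "sym (proj_rel :: (('a ^ 'r) \<times> ('a ^ 'r)) set)"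
  proof (rule symI)
    fix v w :: "'a ^ 'r" assume "(v, w) \<in> proj_rel"
    then obtain c where c: "v \<noteq> 0" "w \<noteq> 0" "c \<noteq> 0" "w = c *s v" by (auto simp: proj_rel_def)
    then have "v = inverse c *s w" by simp
    with c show "(w, v) \<in> proj_rel"
      unfolding proj_rel_def by (metis (mono_tags, lifting) case_prodI mem_Collect_eq nonzero_imp_inverse_nonzero)
  qed
  show "trans (proj_rel :: (('a ^ 'r) \<times> ('a ^ 'r)) set)"
  proof (rule transI)
    fix u v w :: "'a ^ 'r" assume "(u, v) \<in> proj_rel" "(v, w) \<in> proj_rel"
    then obtain c d where "u \<noteq> 0" "w \<noteq> 0" "c \<noteq> 0" "d \<noteq> 0" "v = c *s u" "w = d *s v"
      by (auto simp: proj_rel_def)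
    then have "u \<noteq> 0 \<and> w \<noteq> 0 \<and> d * c \<noteq> 0 \<and> w = (d * c) *s u"
      by simp
    then show "(u, w) \<in> proj_rel"
      unfolding proj_rel_def by blast
  qed
qed (auto simp: proj_rel_def)

text \<open>
  A projective point, being an equivalence class, is its own fibre; the zero vector is excluded
  because its class is empty.
\<close>
lemma proj_class_fibre:
  assumes x: "x \<in> (proj_space :: ('a::field ^ 'r) set set)"
  shows "{v. proj_class v = x} = x"
proof -
  from x obtain w where w: "w \<noteq> 0" "x = proj_rel `` {w}"
    by (auto simp: proj_space_def quotient_def)
  have "v \<in> x" if "proj_class v = x" for v
  proof -
    have "v \<noteq> 0"
    proof
      assume "v = 0"
      then have "x = {}" using that by (auto simp: proj_class_def proj_rel_def)
      then show False using w equiv_class_self[OF equiv_proj_rel, of w] by auto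
    qed
    then show ?thesis
      using that equiv_class_self[OF equiv_proj_rel, of v] by (auto simp: proj_class_def)
  qed
  moreover have "proj_class v = x" if "v \<in> x" for v
    using that w equiv_class_eq[OF equiv_proj_rel, of w v] by (auto simp: proj_class_def)
  ultimately show ?thesis by auto
qed

lemma card_proj_point:
  assumes x: "x \<in> (proj_space :: ('a::{field,finite} ^ 'r) set set)"
  shows "card x = CARD('a) - 1"
proof -
  from x obtain w where w: "w \<noteq> 0" "x = proj_rel `` {w}"
    by (auto simp: proj_space_def quotient_def)
  have "x = (\<lambda>c. c *s w) ` (UNIV - {0})"
    using w by (fastforce simp: proj_rel_def)
  moreover have "inj_on (\<lambda>c. c *s w) (UNIV - {0})"
    using w by (intro inj_onI) (simp only: vector_mul_rcancel simp_thms)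
  ultimately show ?thesis
    by (simp add: card_image card_Diff_singleton)
qed

lemma card_proj_space:
  "card (proj_space :: ('a::{field,finite} ^ 'r::finite) set set) * (CARD('a) - 1) = CARD('a ^ 'r) - 1"
proof -
  have "card (UNIV - {0 :: 'a ^ 'r}) = (\<Sum>x\<in>(proj_space :: ('a ^ 'r) set set). card x)"
    unfolding proj_space_def
    using Union_quotient[OF equiv_proj_rel] quotient_disj[OF equiv_proj_rel]
    by (subst card_Union_disjoint[symmetric]) (auto simp: pairwise_def disjnt_def)
  then show ?thesis
    by (simp add: card_proj_point card_Diff_singleton del: CARD_vec)
qed

theorem theorem1p1:
  fixes M :: "'w measure"
    and \<alpha> :: "'r::finite \<Rightarrow> 'w \<Rightarrow> 'a::{field,finite} fls"
  assumes "prob_space M"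
    and "prob_space.indep_vars M (\<lambda>_. frac_borel) \<alpha> UNIV"
    and "\<And>i. haar_prob (distr M frac_borel (\<alpha> i))"
  defines "\<rho> \<equiv> \<lambda>n \<omega>. residual (\<lambda>i. \<alpha> i \<omega>) n"
    and "J \<equiv> \<lambda>n \<omega>. jump (\<lambda>i. \<alpha> i \<omega>) n"
  shows "prob_space.indep_vars M (\<lambda>_. count_space UNIV) \<rho> UNIV \<and>
         (\<forall>n. distr M (count_space UNIV) (\<rho> n) = uniform_count_measure UNIV) \<and>
         (\<forall>n. \<forall>\<omega>\<in>space M. J n \<omega> = of_bool (\<rho> n \<omega> \<noteq> 0)) \<and>
         prob_space.indep_vars M (\<lambda>_. count_space UNIV) J UNIV \<and>
         (\<forall>n. distr M (count_space UNIV) (J n) =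
                measure_pmf (map_pmf of_bool (bernoulli_pmf (1 - 1 / real CARD('a) ^ CARD('r))))) \<and>
         (\<forall>n. \<P>(\<omega> in M. J n \<omega> = 1) = 1 - 1 / real CARD('a) ^ CARD('r)) \<and>
         (\<forall>n. \<forall>x\<in>(proj_space :: ('a ^ 'r) set set).
            \<P>(\<omega> in M. proj_class (\<rho> n \<omega>) = x \<bar> J n \<omega> = 1) =
              1 / real (card (proj_space :: ('a ^ 'r) set set)))"
proof -
  interpret haar_tuple M \<alpha>
    using assms(1-3) by (intro haar_tuple.intro haar_tuple_axioms.intro)
  have J: "J n \<omega> = of_bool (\<rho> n \<omega> \<noteq> 0)" for n \<omega>
    unfolding J_def \<rho>_def by (rule jump_eq_residual)
  have J_eq_1: "J n \<omega> = 1 \<longleftrightarrow> res n \<omega> \<noteq> 0" for n \<omega>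
    by (simp add: J \<rho>_def)
  have indep_J: "indep_vars (\<lambda>_. count_space UNIV) J UNIV"
  proof -
    have "indep_vars (\<lambda>_. count_space UNIV) (\<lambda>n \<omega>. of_bool (\<rho> n \<omega> \<noteq> 0) :: nat) UNIV"
      unfolding \<rho>_def by (rule indep_vars_compose2[OF indep_res]) simp
    then show ?thesis by (simp add: J[abs_def])
  qed
  have distr_J: "distr M (count_space UNIV) (J n) =
      measure_pmf (map_pmf of_bool (bernoulli_pmf (1 - 1 / real CARD('a) ^ CARD('r))))" for n
    using distr_nonzero_res[of n] by (simp add: J[abs_def] \<rho>_def)
  have prob_J: "\<P>(\<omega> in M. J n \<omega> = 1) = 1 - 1 / real CARD('a) ^ CARD('r)" for n
    unfolding J_eq_1 using prob_res_nonzero[of n] by simp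
  have proj: "\<P>(\<omega> in M. proj_class (\<rho> n \<omega>) = x \<bar> J n \<omega> = 1) =
      1 / real (card (proj_space :: ('a ^ 'r) set set))"
    if x: "x \<in> (proj_space :: ('a ^ 'r) set set)" for n x
  proof -
    define N where "N = real CARD('a ^ 'r)"
    have q: "CARD('a) \<ge> 2"
      using card_mono[of UNIV "{0::'a, 1}"] by simp
    have "CARD('a) ^ 1 \<le> CARD('a) ^ CARD('r)"
      using q by (intro power_increasing) (auto simp: Suc_le_eq)
    then have N: "N \<ge> 2" using q by (simp add: N_def flip: of_nat_power)
    have "0 \<notin> x"
      using x equiv_proj_rel by (auto simp: proj_space_def quotient_def proj_rel_def)
    then have "\<P>(\<omega> in M. proj_class (\<rho> n \<omega>) = x \<and> J n \<omega> = 1) = \<P>(\<omega> in M. res n \<omega> \<in> x)"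
      unfolding J_eq_1 using proj_class_fibre[OF x]
      by (intro arg_cong[where f = prob]) (auto simp: \<rho>_def)
    also have "\<dots> = (real CARD('a) - 1) / N"
      using q by (simp add: prob_res_in card_proj_point[OF x] N_def of_nat_diff)
    finally have joint: "\<P>(\<omega> in M. proj_class (\<rho> n \<omega>) = x \<and> J n \<omega> = 1) = (real CARD('a) - 1) / N" .
    have card: "real (card (proj_space :: ('a ^ 'r) set set)) * (real CARD('a) - 1) = N - 1"
      using arg_cong[OF card_proj_space[where 'a = 'a and 'r = 'r], of real] q N
      by (simp add: of_nat_diff N_def)
    have "\<P>(\<omega> in M. proj_class (\<rho> n \<omega>) = x \<bar> J n \<omega> = 1) = ((real CARD('a) - 1) / N) / (1 - 1 / N)"
      unfolding cond_prob_def joint prob_J by (simp add: N_def)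
    also have "\<dots> = 1 / real (card (proj_space :: ('a ^ 'r) set set))"
    proof -
      have "1 - 1 / N = (N - 1) / N" using N by (simp add: field_simps)
      then have "((real CARD('a) - 1) / N) / (1 - 1 / N) = (real CARD('a) - 1) / (N - 1)"
        using N by simp
      then show ?thesis using q by (simp flip: card)
    qed
    finally show ?thesis .
  qed
  show ?thesis
    using indep_res distr_res J indep_J distr_J prob_J proj by (simp add: \<rho>_def)
qed

end
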